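(* Let $\Gamma_1$ and $\Gamma_2$ be $2\ell$-regular orthogonal signed graphs. Suppose $\Gamma_1$ is splittable at $a,b$ and $\Gamma_2$ is splittable at $a',b'$. If $\Gamma_1$ is $3$-connected, then the split and join $\Gamma_1^{a,b}*\Gamma_2^{a',b'}$ is a $2\ell$-regular orthogonal signed graph.
   Context: A signed graph $\Gamma=(G,\sigma)$ is a simple graph $G$ (the underlying graph) with a function $\sigma:E(G)\to\{1,-1\}$. Graph properties of $\Gamma$ such as regularity and connectivity are those of $G$. Its signed adjacency matrix $A(\Gamma)$ has entry $\sigma(ij)$ at $(i,j)$ if $ij\in E(G)$ and $0$ otherwise. $\Gamma$ is orthogonal if $G$ is connected and $A(\Gamma)^2=D$, where $D$ is the diagonal matrix of vertex degrees of $G$. $N_v=N(v)$ denotes the set of neighbors of $v$ in $G$. Splittable: Let $\Gamma$ be a $2\ell$-regular orthogonal signed graph which possesses distinct vertices $a,b$ such that $|N_a\cap N_b|=2\ell$. Let $P=\{p_1,\dots,p_\ell\}$ be the set of midpoints of the positive 2-walks from $a$ to $b$, i.e. the $w\in N_a\cap N_b$ with $\sigma(aw)\sigma(wb)=1$, and let $M=\{m_1,\dots,m_\ell\}$ be the set of midpoints of the negative 2-walks from $a$ to $b$, i.e. the $w\in N_a\cap N_b$ with $\sigma(aw)\sigma(wb)=-1$ (each set has size $\ell$ by orthogonality). $\Gamma$ is splittable at $a,b$ if $a$ and $b$ are the only vertices of $\Gamma$ that have neighbors in both $P$ and $M$. Split and join: Let $\Gamma_1$ be splittable at $a,b$ with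 corresponding sets $P=\{p_1,\dots,p_\ell\}$, $M=\{m_1,\dots,m_\ell\}$, and let $\Gamma_2$ be splittable at $a',b'$ with corresponding sets $P'=\{p_1',\dots,p_\ell'\}$, $M'=\{m_1',\dots,m_\ell'\}$. The split and join $\Gamma_1^{a,b}*\Gamma_2^{a',b'}$ is the signed graph obtained from the disjoint union of $\Gamma_1$ and $\Gamma_2$ by deleting $a,b,a',b'$ and their incident edges and creating new vertices $a_1,a_2,b_1,b_2$ with $N(a_1)=N(a_2)=\{p_1,\dots,p_\ell,m_1',\dots,m_\ell'\}$ and $N(b_1)=N(b_2)=\{p_1',\dots,p_\ell',m_1,\dots,m_\ell\}$, where the edges $\{a_1,m_i'\}$ and $\{b_2,m_i\}$ ($1\leqslant i\leqslant\ell$) are negative and all other new edges are positive.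
   Formalization: The split and join is formed after switching each graph so that all edges at a (resp. a') are positive; for arbitrary signs the claim fails, since two positive midpoints joined to a by edges of different signs get non-orthogonal rows. *)

theory Defs
  imports "Graph_Theory.Digraph_Component"
begin

text \<open>
  The underlying graph is a finite simple graph in the sense of the locale \<^locale>\<open>pair_graph\<close>:
  an edge \<open>uv\<close> is represented by the two arcs \<open>(u,v)\<close> and \<open>(v,u)\<close>. The signature takes the
  unordered edge \<open>{u,v}\<close>; its values outside the edge set are irrelevant.
\<close>

record 'a sgraph =
  ugraph :: "'a pair_pre_digraph"
  esign :: "'a set \<Rightarrow> int"

abbreviation svertices :: "'a sgraph \<Rightarrow> 'a set" where
  "svertices \<Gamma> \<equiv> pverts (ugraph \<Gamma>)"

definition signed_graph :: "'a sgraph \<Rightarrow> bool" where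
  "signed_graph \<Gamma> \<longleftrightarrow> pair_graph (ugraph \<Gamma>) \<and>
     (\<forall>(u, v) \<in> parcs (ugraph \<Gamma>). esign \<Gamma> {u, v} \<in> {1, -1})"

definition nbrs :: "'a sgraph \<Rightarrow> 'a \<Rightarrow> 'a set" where
  "nbrs \<Gamma> v = {w. (v, w) \<in> parcs (ugraph \<Gamma>)}"

definition regular :: "nat \<Rightarrow> 'a sgraph \<Rightarrow> bool" where
  "regular k \<Gamma> \<longleftrightarrow> (\<forall>v \<in> svertices \<Gamma>. card (nbrs \<Gamma> v) = k)"

text \<open>
  As usual, a \<open>k\<close>-connected graph has more than \<open>k\<close> vertices and stays connected after the removal
  of fewer than \<open>k\<close> vertices.
\<close>

definition k_connected :: "nat \<Rightarrow> 'a sgraph \<Rightarrow> bool" where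
  "k_connected k \<Gamma> \<longleftrightarrow> k < card (svertices \<Gamma>) \<and>
     (\<forall>S \<subseteq> svertices \<Gamma>. card S < k \<longrightarrow>
        connected (with_proj (ugraph \<Gamma>) \<restriction> (svertices \<Gamma> - S)))"

text \<open>Matrices with rows and columns indexed by the vertex set are functions of two vertices.\<close>

definition adj_mat :: "'a sgraph \<Rightarrow> 'a \<Rightarrow> 'a \<Rightarrow> int" where
  "adj_mat \<Gamma> u v = (if (u, v) \<in> parcs (ugraph \<Gamma>) then esign \<Gamma> {u, v} else 0)"

definition degree_mat :: "'a sgraph \<Rightarrow> 'a \<Rightarrow> 'a \<Rightarrow> int" where
  "degree_mat \<Gamma> u v = (if u = v then int (card (nbrs \<Gamma> u)) else 0)"

definition mat_prod :: "'a set \<Rightarrow> ('a \<Rightarrow> 'a \<Rightarrow> int) \<Rightarrow> ('a \<Rightarrow> 'a \<Rightarrow> int) \<Rightarrow> 'a \<Rightarrow> 'a \<Rightarrow> int" where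
  "mat_prod V A B u v = (\<Sum>w\<in>V. A u w * B w v)"

definition orthogonal :: "'a sgraph \<Rightarrow> bool" where
  "orthogonal \<Gamma> \<longleftrightarrow> signed_graph \<Gamma> \<and> connected (with_proj (ugraph \<Gamma>)) \<and>
     (\<forall>u \<in> svertices \<Gamma>. \<forall>v \<in> svertices \<Gamma>.
        mat_prod (svertices \<Gamma>) (adj_mat \<Gamma>) (adj_mat \<Gamma>) u v = degree_mat \<Gamma> u v)"

definition pos_mid :: "'a sgraph \<Rightarrow> 'a \<Rightarrow> 'a \<Rightarrow> 'a set" where
  "pos_mid \<Gamma> a b = {w \<in> nbrs \<Gamma> a \<inter> nbrs \<Gamma> b. esign \<Gamma> {a, w} * esign \<Gamma> {w, b} = 1}"

definition neg_mid :: "'a sgraph \<Rightarrow> 'a \<Rightarrow> 'a \<Rightarrow> 'a set" where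
  "neg_mid \<Gamma> a b = {w \<in> nbrs \<Gamma> a \<inter> nbrs \<Gamma> b. esign \<Gamma> {a, w} * esign \<Gamma> {w, b} = -1}"

definition splittable :: "nat \<Rightarrow> 'a sgraph \<Rightarrow> 'a \<Rightarrow> 'a \<Rightarrow> bool" where
  "splittable l \<Gamma> a b \<longleftrightarrow>
     orthogonal \<Gamma> \<and> regular (2 * l) \<Gamma> \<and>
     a \<in> svertices \<Gamma> \<and> b \<in> svertices \<Gamma> \<and> a \<noteq> b \<and>
     card (nbrs \<Gamma> a \<inter> nbrs \<Gamma> b) = 2 * l \<and>
     {v \<in> svertices \<Gamma>. nbrs \<Gamma> v \<inter> pos_mid \<Gamma> a b \<noteq> {} \<and> nbrs \<Gamma> v \<inter> neg_mid \<Gamma> a b \<noteq> {}} = {a, b}"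

text \<open>
  Switching at \<open>X\<close> negates the edges with exactly one end in \<open>X\<close>. The split and join replaces the
  edges at \<open>a\<close> and \<open>b\<close> by edges with prescribed signs, so it depends on the signs of the edges at
  \<open>a\<close> (those at \<open>b\<close> are then determined by the positive and negative midpoints). As usual for
  signed graphs, the representative in the switching class is chosen such that all edges at \<open>a\<close>
  are positive. Without this convention the result need not be orthogonal: two
  positive midpoints that are joined to \<open>a\<close> by edges of different signs have non-orthogonal rows
  in the signed graph constructed below.
\<close>

definition switch :: "'a set \<Rightarrow> 'a sgraph \<Rightarrow> 'a sgraph" where
  "switch X \<Gamma> = \<Gamma>\<lparr>esign := (\<lambda>e. if card (e \<inter> X) = 1 then - esign \<Gamma> e else esign \<Gamma> e)\<rparr>"

definition normalise :: "'a \<Rightarrow> 'a sgraph \<Rightarrow> 'a sgraph" where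
  "normalise a \<Gamma> = switch {w \<in> nbrs \<Gamma> a. esign \<Gamma> {a, w} = -1} \<Gamma>"

lemma normalise_id:
  assumes "\<And>w. w \<in> nbrs \<Gamma> a \<Longrightarrow> esign \<Gamma> {a, w} = 1"
  shows "normalise a \<Gamma> = \<Gamma>"
proof -
  have empty: "{w \<in> nbrs \<Gamma> a. esign \<Gamma> {a, w} = -1} = {}"
    using assms by auto
  show ?thesis unfolding normalise_def empty by (simp add: switch_def)
qed

lemma esign_normalise:
  assumes "signed_graph \<Gamma>" and "w \<in> nbrs \<Gamma> a"
  shows "esign (normalise a \<Gamma>) {a, w} = 1"
proof -
  let ?X = "{w \<in> nbrs \<Gamma> a. esign \<Gamma> {a, w} = -1}"
  from assms(1) have "(a, a) \<notin> parcs (ugraph \<Gamma>)"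
    using pair_loopfree_digraph.no_loops'[of "ugraph \<Gamma>" a a]
    by (auto simp: signed_graph_def pair_graph_def pair_digraph_def)
  then have "a \<notin> ?X" by (simp add: nbrs_def)
  moreover have "esign \<Gamma> {a, w} \<in> {1, -1}"
    using assms by (auto simp: signed_graph_def nbrs_def)
  ultimately show ?thesis
    using assms(2) by (auto simp: normalise_def switch_def Int_insert_left)
qed

text \<open>The vertices of the split and join: copies of the old vertices, and \<open>a\<^sub>1, a\<^sub>2, b\<^sub>1, b\<^sub>2\<close>.\<close>

datatype ('a, 'b) sj_vertex = Left 'a | Right 'b | A1 | A2 | B1 | B2

definition sj_new_arcs ::
  "'a sgraph \<Rightarrow> 'a \<Rightarrow> 'a \<Rightarrow> 'b sgraph \<Rightarrow> 'b \<Rightarrow> 'b \<Rightarrow> ('a, 'b) sj_vertex rel" where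
  "sj_new_arcs \<Gamma>1 a b \<Gamma>2 a' b' =
     {A1, A2} \<times> (Left ` pos_mid \<Gamma>1 a b \<union> Right ` neg_mid \<Gamma>2 a' b') \<union>
     {B1, B2} \<times> (Right ` pos_mid \<Gamma>2 a' b' \<union> Left ` neg_mid \<Gamma>1 a b)"

definition split_join ::
  "'a sgraph \<Rightarrow> 'a \<Rightarrow> 'a \<Rightarrow> 'b sgraph \<Rightarrow> 'b \<Rightarrow> 'b \<Rightarrow> ('a, 'b) sj_vertex sgraph" where
  "split_join \<Gamma>1 a b \<Gamma>2 a' b' =
     \<lparr> ugraph =
         \<lparr> pverts = Left ` (svertices \<Gamma>1 - {a, b}) \<union> Right ` (svertices \<Gamma>2 - {a', b'}) \<union>
             {A1, A2, B1, B2},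
           parcs =
             {(Left u, Left v) | u v. (u, v) \<in> parcs (ugraph \<Gamma>1) \<and> u \<notin> {a, b} \<and> v \<notin> {a, b}} \<union>
             {(Right u, Right v) | u v. (u, v) \<in> parcs (ugraph \<Gamma>2) \<and> u \<notin> {a', b'} \<and> v \<notin> {a', b'}} \<union>
             sj_new_arcs \<Gamma>1 a b \<Gamma>2 a' b' \<union> (sj_new_arcs \<Gamma>1 a b \<Gamma>2 a' b')\<inverse> \<rparr>,
       esign = (\<lambda>e.
         if e \<subseteq> range Left then esign \<Gamma>1 (Left -` e)
         else if e \<subseteq> range Right then esign \<Gamma>2 (Right -` e)
         else if (\<exists>m \<in> neg_mid \<Gamma>2 a' b'. e = {A1, Right m}) \<or>
                 (\<exists>m \<in> neg_mid \<Gamma>1 a b. e = {B2, Left m}) then -1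
         else 1) \<rparr>"

end

theory Submission
  imports Defs
begin

text \<open>
  After switching so that all edges at \<open>a\<close> are positive, the row of \<open>a\<close> is \<open>1\<close> on \<open>P \<union> M\<close>, that of
  \<open>b\<close> is \<open>1\<close> on \<open>P\<close> and \<open>-1\<close> on \<open>M\<close>, and both vanish elsewhere. For old vertices \<open>u, v\<close> on the same side,
  the pair \<open>a, b\<close> therefore contributes \<open>2\<close> to their inner product if both lie in \<open>P\<close> or both in \<open>M\<close>,
  and \<open>0\<close> otherwise, which is exactly what \<open>a\<^sub>1, a\<^sub>2, b\<^sub>1, b\<^sub>2\<close> contribute. Vertices on different
  sides only meet in a pair \<open>a\<^sub>1, a\<^sub>2\<close> or \<open>b\<^sub>1, b\<^sub>2\<close>, whose two contributions cancel. An old and a new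
  vertex are orthogonal because each old row sums to zero over \<open>P\<close> and over \<open>M\<close>; two new vertices
  because \<open>P\<close> and \<open>M\<close> have the same size. The degrees are the diagonal entries of the squared
  matrix. For connectivity, \<open>\<Gamma>1\<close> without \<open>a, b\<close> stays connected and is adjacent to all four new
  vertices, and every component of \<open>\<Gamma>2\<close> without \<open>a', b'\<close> meets \<open>P' \<union> M'\<close>, hence is adjacent to a
  new vertex.
\<close>

section \<open>Connectivity\<close>

text \<open>Connectedness is taken in the symmetric closure: a walk from \<open>u\<close> to
  \<open>v\<close> may use an arc in either direction, so \<open>P\<close> has to be passed on both
  ways.\<close>

lemma connected_induct:
  assumes "connected G" and "u \<in> verts G" and "v \<in> verts G" and "P u"
    and "\<And>x y. \<lbrakk>x \<in> verts G; y \<in> verts G; (x, y) \<in> arcs_ends G \<or> (y, x) \<in> arcs_ends G; P x\<rbrakk> \<Longrightarrow> P y"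
  shows "P v"
proof -
  have "(u, v) \<in> rtrancl_on (verts G) ((arcs_ends G)\<^sup>s)"
    using assms(1-3) by (auto simp: connected_conv)
  then show ?thesis
  proof (induct rule: rtrancl_on_induct)
    case base
    then show ?case using assms(4) by simp
  next
    case (step y z)
    from step(2) have "(y, z) \<in> arcs_ends G \<or> (z, y) \<in> arcs_ends G"
      by (auto simp: symcl_def)
    with step assms(5)[of y z] show ?case by blast
  qed
qed

text \<open>Arcs are symmetric, so a walk from \<open>r\<close> to \<open>u\<close> can be reversed
  and then continued by one from \<open>r\<close> to \<open>v\<close>.\<close>

lemma (in pair_pseudo_graph) connected_if_root:
  assumes "r \<in> pverts G" and "\<And>v. v \<in> pverts G \<Longrightarrow> (r, v) \<in> (parcs G)\<^sup>*"
  shows "connected (with_proj G)"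
proof -
  have sym: "sym (parcs G)"
    using pair_sym_arcs by (simp add: symmetric_def)
  have "(u, v) \<in> rtrancl_on (pverts G) ((parcs G)\<^sup>s)"
    if "u \<in> pverts G" and "v \<in> pverts G" for u v
  proof (rule rtrancl_consistent_rtrancl_on)
    have "(u, r) \<in> (parcs G)\<^sup>*"
      using assms(2)[OF that(1)] sym_rtrancl[OF sym] by (auto dest: symD)
    then have "(u, v) \<in> (parcs G)\<^sup>*"
      using assms(2)[OF that(2)] by (rule rtrancl_trans)
    then show "(u, v) \<in> ((parcs G)\<^sup>s)\<^sup>*"
      using rtrancl_mono[of "parcs G" "(parcs G)\<^sup>s"] by (auto simp: symcl_def)
  qed (use that in_arcsD1 in_arcsD2 in \<open>auto simp: symcl_def\<close>)
  then show ?thesis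
    using assms(1) by (auto simp: connected_conv)
qed

section \<open>Signed adjacency matrices\<close>

context
  fixes \<Gamma> :: "'a sgraph"
  assumes sg: "signed_graph \<Gamma>"
begin

interpretation pair_graph "ugraph \<Gamma>"
  using sg by (simp add: signed_graph_def)

lemma finite_svertices: "finite (svertices \<Gamma>)"
  by (rule pair_finite_verts)

lemma nbrs_subset: "nbrs \<Gamma> v \<subseteq> svertices \<Gamma>"
  by (auto simp: nbrs_def intro: in_arcsD2)

lemma finite_nbrs: "finite (nbrs \<Gamma> v)"
  using nbrs_subset finite_svertices by (rule finite_subset)

lemma not_in_own_nbrs: "v \<notin> nbrs \<Gamma> v"
  using no_loops'[of v v] by (auto simp: nbrs_def)

lemma parcs_commute: "(u, v) \<in> parcs (ugraph \<Gamma>) \<longleftrightarrow> (v, u) \<in> parcs (ugraph \<Gamma>)"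
  using pair_sym_arcs by (auto simp: symmetric_def dest: symD)

lemma nbrs_commute: "u \<in> nbrs \<Gamma> v \<longleftrightarrow> v \<in> nbrs \<Gamma> u"
  using parcs_commute by (simp add: nbrs_def)

lemma esign_cases: "w \<in> nbrs \<Gamma> v \<Longrightarrow> esign \<Gamma> {v, w} = 1 \<or> esign \<Gamma> {v, w} = -1"
  using sg by (auto simp: signed_graph_def nbrs_def)

lemma adj_mat_commute: "adj_mat \<Gamma> u v = adj_mat \<Gamma> v u"
  using parcs_commute by (simp add: adj_mat_def insert_commute)

text \<open>Nonzero entries are \<open>1\<close> or \<open>-1\<close> and square to
  \<open>1\<close>, so the diagonal counts neighbours. This later turns the matrix equation into
  regularity.\<close>

lemma mat_prod_adj_mat_diag:
  "mat_prod (svertices \<Gamma>) (adj_mat \<Gamma>) (adj_mat \<Gamma>) u u = int (card (nbrs \<Gamma> u))"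
proof -
  have "adj_mat \<Gamma> u w * adj_mat \<Gamma> w u = (if w \<in> nbrs \<Gamma> u then 1 else 0)" for w
    using esign_cases[of w u] unfolding adj_mat_commute[of w u] by (auto simp: adj_mat_def nbrs_def)
  then have "mat_prod (svertices \<Gamma>) (adj_mat \<Gamma>) (adj_mat \<Gamma>) u u
      = (\<Sum>w\<in>svertices \<Gamma>. if w \<in> nbrs \<Gamma> u then 1 else 0)"
    by (simp add: mat_prod_def)
  also have "\<dots> = int (card (nbrs \<Gamma> u))"
    using nbrs_subset finite_svertices by (simp add: sum.If_cases Int_absorb1)
  finally show ?thesis .
qed

end

section \<open>Switching\<close>

lemma svertices_normalise [simp]: "svertices (normalise a \<Gamma>) = svertices \<Gamma>"
  and ugraph_normalise [simp]: "ugraph (normalise a \<Gamma>) = ugraph \<Gamma>"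
  and nbrs_normalise [simp]: "nbrs (normalise a \<Gamma>) v = nbrs \<Gamma> v"
  and regular_normalise [simp]: "regular k (normalise a \<Gamma>) = regular k \<Gamma>"
  by (simp_all add: normalise_def switch_def nbrs_def regular_def)

lemma signed_graph_switch:
  assumes "signed_graph \<Gamma>"
  shows "signed_graph (switch X \<Gamma>)"
  using assms by (auto simp: signed_graph_def switch_def)

text \<open>Switching is conjugation by the diagonal matrix with \<open>-1\<close> exactly on
  \<open>X\<close>: the two signs cancel unless the edge has exactly one end in
  \<open>X\<close>.\<close>

lemma adj_mat_switch:
  assumes "signed_graph \<Gamma>"
  shows "adj_mat (switch X \<Gamma>) u v
    = (if u \<in> X then -1 else 1) * (if v \<in> X then -1 else 1) * adj_mat \<Gamma> u v"
proof (cases "(u, v) \<in> parcs (ugraph \<Gamma>)")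
  case True
  then have "u \<noteq> v" using not_in_own_nbrs[OF assms, of u] by (auto simp: nbrs_def)
  with True show ?thesis
    by (auto simp: adj_mat_def switch_def Int_insert_left)
qed (simp add: adj_mat_def switch_def)

text \<open>The sign of the middle vertex occurs twice in each term of the product and disappears;
  the diagonal matrix of degrees is unchanged by the conjugation.\<close>

lemma orthogonal_switch:
  assumes "orthogonal \<Gamma>"
  shows "orthogonal (switch X \<Gamma>)"
proof -
  let ?s = "\<lambda>v. if v \<in> X then -1 else 1 :: int"
  have sg: "signed_graph \<Gamma>" using assms by (simp add: orthogonal_def)
  have eq: "ugraph (switch X \<Gamma>) = ugraph \<Gamma>" by (simp add: switch_def)
  have prod: "mat_prod V (adj_mat (switch X \<Gamma>)) (adj_mat (switch X \<Gamma>)) u v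
      = ?s u * ?s v * mat_prod V (adj_mat \<Gamma>) (adj_mat \<Gamma>) u v" for V u v
    unfolding mat_prod_def adj_mat_switch[OF sg] sum_distrib_left
    by (intro sum.cong) auto
  have "degree_mat (switch X \<Gamma>) u v = ?s u * ?s v * degree_mat \<Gamma> u v" for u v
    by (simp add: degree_mat_def nbrs_def switch_def)
  with prod show ?thesis
    using assms signed_graph_switch[OF sg] by (simp add: orthogonal_def eq)
qed

section \<open>Twins with positive edges\<close>

text \<open>The situation after normalising: in a \<open>2 * l\<close>-regular graph,
  \<open>2 * l\<close> common neighbours force equal neighbourhoods.\<close>

locale positive_twins =
  fixes \<Gamma> :: "'a sgraph" and a b :: 'a and l :: nat
  assumes orth: "orthogonal \<Gamma>" and reg: "regular (2 * l) \<Gamma>"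
    and a_in: "a \<in> svertices \<Gamma>" and b_in: "b \<in> svertices \<Gamma>" and a_neq_b: "a \<noteq> b"
    and twins: "nbrs \<Gamma> b = nbrs \<Gamma> a"
    and positive: "w \<in> nbrs \<Gamma> a \<Longrightarrow> esign \<Gamma> {a, w} = 1"
begin

abbreviation "V \<equiv> svertices \<Gamma> - {a, b}"
abbreviation "P \<equiv> pos_mid \<Gamma> a b"
abbreviation "M \<equiv> neg_mid \<Gamma> a b"
abbreviation "A \<equiv> adj_mat \<Gamma>"

lemma sg: "signed_graph \<Gamma>"
  using orth by (simp add: orthogonal_def)

lemma conn: "connected (with_proj (ugraph \<Gamma>))"
  using orth by (simp add: orthogonal_def)

lemma fin: "finite V"
  using finite_svertices[OF sg] by simp

lemma mat_prod_A:
  assumes "u \<in> svertices \<Gamma>" and "v \<in> svertices \<Gamma>"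
  shows "mat_prod (svertices \<Gamma>) A A u v = (if u = v then 2 * int l else 0)"
  using assms orth reg by (simp add: orthogonal_def regular_def degree_mat_def)

lemma P_Un_M: "P \<union> M = nbrs \<Gamma> a"
  using esign_cases[OF sg, of _ b] twins positive
  by (force simp: pos_mid_def neg_mid_def insert_commute)

lemma P_Int_M: "P \<inter> M = {}"
  by (auto simp: pos_mid_def neg_mid_def)

lemma nbrs_a_subset: "nbrs \<Gamma> a \<subseteq> V"
  using nbrs_subset[OF sg, of a] not_in_own_nbrs[OF sg] twins by blast

lemma P_subset: "P \<subseteq> V" and M_subset: "M \<subseteq> V"
  using nbrs_a_subset P_Un_M by auto

lemma finite_P: "finite P" and finite_M: "finite M"
  using P_subset M_subset fin by (auto intro: finite_subset)

text \<open>Indicator form, so that products with this row split linearly into sums over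
  \<open>P\<close> and \<open>M\<close>.\<close>

lemma A_a: "A w a = of_bool (w \<in> P) + of_bool (w \<in> M)"
proof -
  have "A a w = of_bool (w \<in> nbrs \<Gamma> a)"
    using positive by (simp add: adj_mat_def nbrs_def)
  then show ?thesis
    using P_Un_M P_Int_M by (auto simp: adj_mat_commute[OF sg, of w])
qed

lemma A_b: "A w b = of_bool (w \<in> P) - of_bool (w \<in> M)"
proof -
  have "w \<in> P \<Longrightarrow> esign \<Gamma> {w, b} = 1" "w \<in> M \<Longrightarrow> esign \<Gamma> {w, b} = -1"
    using positive by (auto simp: pos_mid_def neg_mid_def)
  then have "A w b = (if w \<in> P then 1 else if w \<in> M then -1 else 0)"
    using P_Un_M P_Int_M nbrs_commute[OF sg, of w b] twins
    by (auto simp: adj_mat_def nbrs_def)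
  then show ?thesis
    using P_Int_M by auto
qed

section \<open>Inner products over the vertices other than \<open>a\<close> and
  \<open>b\<close>\<close>

lemma sum_svertices: "(\<Sum>w\<in>svertices \<Gamma>. f w) = (\<Sum>w\<in>V. f w) + f a + f b" for f :: "'a \<Rightarrow> int"
  using sum.subset_diff[of "{a, b}" "svertices \<Gamma>" f] finite_svertices[OF sg] a_in b_in a_neq_b
  by simp

lemma sum_of_bool_P: "(\<Sum>w\<in>V. f w * of_bool (w \<in> P)) = (\<Sum>w\<in>P. f w)"
  and sum_of_bool_M: "(\<Sum>w\<in>V. f w * of_bool (w \<in> M)) = (\<Sum>w\<in>M. f w)" for f :: "'a \<Rightarrow> int"
  using P_subset M_subset fin
  by (auto simp: of_bool_def if_distrib[of "(*) _"] sum.If_cases Int_absorb1 cong: if_cong)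

lemma sum_A_A:
  assumes "u \<in> V" and "v \<in> V"
  shows "(\<Sum>w\<in>V. A u w * A w v) = (if u = v then 2 * int l else 0)
    - 2 * of_bool (u \<in> P \<and> v \<in> P) - 2 * of_bool (u \<in> M \<and> v \<in> M)"
  using mat_prod_A[of u v] assms P_Int_M
  by (auto simp: mat_prod_def sum_svertices A_a A_b adj_mat_commute[OF sg, of a] adj_mat_commute[OF sg, of b])

lemma A_diag: "A u u = 0"
  using not_in_own_nbrs[OF sg, of u] by (simp add: adj_mat_def nbrs_def)

text \<open>The rows of \<open>a\<close> and \<open>b\<close> agree on \<open>P\<close> and are opposite on \<open>M\<close>, so orthogonality
  to both of them makes the two partial row sums vanish separately.\<close>

lemma sum_A_P_M:
  assumes "u \<in> V"
  shows "(\<Sum>w\<in>P. A u w) = 0" and "(\<Sum>w\<in>M. A u w) = 0"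
proof -
  \<comment> \<open>\<open>a\<close> and \<open>b\<close> are not adjacent. Together with the zero
    diagonal this removes the terms at \<open>a\<close> and \<open>b\<close> from both inner
    products.\<close>
  have ab: "A a b = 0" "A b a = 0"
    using nbrs_a_subset nbrs_commute[OF sg, of a b] by (auto simp: adj_mat_def nbrs_def)
  have "(\<Sum>w\<in>V. A u w * A w a) = 0" "(\<Sum>w\<in>V. A u w * A w b) = 0"
    using mat_prod_A[of u a] mat_prod_A[of u b] assms a_in b_in ab
    by (auto simp: mat_prod_def sum_svertices A_diag split: if_splits)
  then have "(\<Sum>w\<in>P. A u w) + (\<Sum>w\<in>M. A u w) = 0" "(\<Sum>w\<in>P. A u w) - (\<Sum>w\<in>M. A u w) = 0"
    by (simp_all add: A_a A_b distrib_left right_diff_distrib sum.distrib sum_subtractf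
        sum_of_bool_P sum_of_bool_M)
  then show "(\<Sum>w\<in>P. A u w) = 0" and "(\<Sum>w\<in>M. A u w) = 0"
    by simp_all
qed

text \<open>Orthogonality of the rows of \<open>a\<close> and \<open>b\<close> balances
  \<open>P\<close> against \<open>M\<close>, and together these make up the \<open>2 * l\<close>
  neighbours of \<open>a\<close>.\<close>

lemma card_P: "card P = l" and card_M: "card M = l"
proof -
  have "card P + card M = 2 * l"
    using P_Un_M P_Int_M finite_P finite_M a_in reg
    by (simp add: regular_def flip: card_Un_disjoint)
  moreover have "int (card P) - int (card M) = 0"
  proof -
    have "(\<Sum>w\<in>V. A a w * A w b) = 0"
      using mat_prod_A[OF a_in b_in] a_neq_b
      by (simp add: mat_prod_def sum_svertices A_diag)
    moreover have "A a w * A w b = 1 * of_bool (w \<in> P) - 1 * of_bool (w \<in> M)" for w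
      unfolding adj_mat_commute[OF sg, of a w] using P_Int_M by (auto simp: A_a A_b)
    \<comment> \<open>The explicit factor \<open>1\<close> gives the sums the shape of
      \<open>sum_of_bool_P\<close> and \<open>sum_of_bool_M\<close>.\<close>
    ultimately have "(\<Sum>w\<in>V. 1 * of_bool (w \<in> P)) - (\<Sum>w\<in>V. 1 * of_bool (w \<in> M)) = (0 :: int)"
      by (simp only: sum_subtractf)
    then show ?thesis
      by (simp only: sum_of_bool_P sum_of_bool_M) simp
  qed
  ultimately show "card P = l" and "card M = l" by simp_all
qed

lemma sum_P_M:
  "(\<Sum>w\<in>V. of_bool (w \<in> P) * of_bool (w \<in> P)) = int l"
  "(\<Sum>w\<in>V. of_bool (w \<in> M) * of_bool (w \<in> M)) = int l"
  "(\<Sum>w\<in>V. of_bool (w \<in> P) * of_bool (w \<in> M)) = (0 :: int)"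
  "(\<Sum>w\<in>V. of_bool (w \<in> M) * of_bool (w \<in> P)) = (0 :: int)"
proof -
  show "(\<Sum>w\<in>V. of_bool (w \<in> P) * of_bool (w \<in> P)) = int l"
    unfolding sum_of_bool_P using card_P by simp
  show "(\<Sum>w\<in>V. of_bool (w \<in> M) * of_bool (w \<in> M)) = int l"
    unfolding sum_of_bool_M using card_M by simp
  show "(\<Sum>w\<in>V. of_bool (w \<in> P) * of_bool (w \<in> M)) = (0 :: int)"
    "(\<Sum>w\<in>V. of_bool (w \<in> M) * of_bool (w \<in> P)) = (0 :: int)"
    using P_Int_M by (auto intro!: sum.neutral)
qed

text \<open>With \<open>l = 0\<close> there would be no edges, contradicting connectedness since
  \<open>a \<noteq> b\<close>. Positivity supplies the midpoints through which the new graph is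
  connected.\<close>

lemma l_pos: "l > 0"
proof (rule ccontr)
  assume "\<not> l > 0"
  then have empty: "nbrs \<Gamma> v = {}" if "v \<in> svertices \<Gamma>" for v
    using that reg finite_nbrs[OF sg] by (simp add: regular_def)
  have "b = a"
    by (rule connected_induct[OF conn, of a b "\<lambda>x. x = a"])
      (use a_in b_in empty in \<open>auto simp: nbrs_def\<close>)
  with a_neq_b show False by simp
qed

lemma P_M_nonempty: "P \<noteq> {}" "M \<noteq> {}"
  using l_pos card_P card_M by auto

end

lemma positive_twins_normalise:
  assumes "splittable l \<Gamma> a b"
  shows "positive_twins (normalise a \<Gamma>) a b l"
proof
  note s = assms[unfolded splittable_def]
  have sg: "signed_graph \<Gamma>" using s by (simp add: orthogonal_def)
  show "orthogonal (normalise a \<Gamma>)"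
    unfolding normalise_def using s by (intro orthogonal_switch) simp
  have "card (nbrs \<Gamma> a) = 2 * l" "card (nbrs \<Gamma> b) = 2 * l" "card (nbrs \<Gamma> a \<inter> nbrs \<Gamma> b) = 2 * l"
    using s by (simp_all add: regular_def)
  then have "nbrs \<Gamma> a \<inter> nbrs \<Gamma> b = nbrs \<Gamma> a" "nbrs \<Gamma> a \<inter> nbrs \<Gamma> b = nbrs \<Gamma> b"
    using finite_nbrs[OF sg] by (simp_all add: card_subset_eq)
  then show "nbrs (normalise a \<Gamma>) b = nbrs (normalise a \<Gamma>) a" by simp
  show "esign (normalise a \<Gamma>) {a, w} = 1" if "w \<in> nbrs (normalise a \<Gamma>) a" for w
    using esign_normalise[OF sg] that by simp
qed (use assms in \<open>simp_all add: splittable_def\<close>)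

section \<open>The split and join\<close>

locale twin_pairs =
  L: positive_twins \<Gamma>1 a b l + R: positive_twins \<Gamma>2 a' b' l
  for \<Gamma>1 :: "'a sgraph" and a b and \<Gamma>2 :: "'b sgraph" and a' b' and l
begin

abbreviation "\<Gamma> \<equiv> split_join \<Gamma>1 a b \<Gamma>2 a' b'"
abbreviation "A \<equiv> adj_mat \<Gamma>"
abbreviation "E \<equiv> parcs (ugraph \<Gamma>)"

section \<open>Arcs and signs of the split and join\<close>

lemma svertices_split_join:
  "svertices \<Gamma> = Left ` L.V \<union> Right ` R.V \<union> {A1, A2, B1, B2}"
  by (simp add: split_join_def)

lemma arcs_split_join [simp]:
  "(Left u, Left v) \<in> E \<longleftrightarrow> (u, v) \<in> parcs (ugraph \<Gamma>1) \<and> u \<notin> {a, b} \<and> v \<notin> {a, b}"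
  "(Right x, Right y) \<in> E \<longleftrightarrow> (x, y) \<in> parcs (ugraph \<Gamma>2) \<and> x \<notin> {a', b'} \<and> y \<notin> {a', b'}"
  "(Left u, Right x) \<notin> E" "(Right x, Left u) \<notin> E"
  "(Left u, A1) \<in> E \<longleftrightarrow> u \<in> L.P" "(A1, Left u) \<in> E \<longleftrightarrow> u \<in> L.P"
  "(Left u, A2) \<in> E \<longleftrightarrow> u \<in> L.P" "(A2, Left u) \<in> E \<longleftrightarrow> u \<in> L.P"
  "(Left u, B1) \<in> E \<longleftrightarrow> u \<in> L.M" "(B1, Left u) \<in> E \<longleftrightarrow> u \<in> L.M"
  "(Left u, B2) \<in> E \<longleftrightarrow> u \<in> L.M" "(B2, Left u) \<in> E \<longleftrightarrow> u \<in> L.M"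
  "(Right x, A1) \<in> E \<longleftrightarrow> x \<in> R.M" "(A1, Right x) \<in> E \<longleftrightarrow> x \<in> R.M"
  "(Right x, A2) \<in> E \<longleftrightarrow> x \<in> R.M" "(A2, Right x) \<in> E \<longleftrightarrow> x \<in> R.M"
  "(Right x, B1) \<in> E \<longleftrightarrow> x \<in> R.P" "(B1, Right x) \<in> E \<longleftrightarrow> x \<in> R.P"
  "(Right x, B2) \<in> E \<longleftrightarrow> x \<in> R.P" "(B2, Right x) \<in> E \<longleftrightarrow> x \<in> R.P"
  "s \<in> {A1, A2, B1, B2} \<Longrightarrow> t \<in> {A1, A2, B1, B2} \<Longrightarrow> (s, t) \<notin> E"
  by (auto simp: split_join_def sj_new_arcs_def)

lemma esign_Left: "esign \<Gamma> {Left u, Left v} = esign \<Gamma>1 {u, v}"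
proof -
  have "Left -` {Left u, Left v :: ('a, 'b) sj_vertex} = {u, v}" by auto
  then show ?thesis by (simp add: split_join_def)
qed

lemma esign_Right: "esign \<Gamma> {Right x, Right y} = esign \<Gamma>2 {x, y}"
proof -
  have "Right -` {Right x, Right y :: ('a, 'b) sj_vertex} = {x, y}" by auto
  then show ?thesis by (auto simp: split_join_def)
qed

text \<open>The two negative cases need a midpoint premise because the signature defaults to
  \<open>1\<close> away from the negative midpoints.\<close>

lemma esign_new:
  "esign \<Gamma> {Left u, A1} = 1" "esign \<Gamma> {Left u, A2} = 1" "esign \<Gamma> {Left u, B1} = 1"
  "u \<in> L.M \<Longrightarrow> esign \<Gamma> {Left u, B2} = -1"
  "x \<in> R.M \<Longrightarrow> esign \<Gamma> {Right x, A1} = -1"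
  "esign \<Gamma> {Right x, A2} = 1" "esign \<Gamma> {Right x, B1} = 1" "esign \<Gamma> {Right x, B2} = 1"
proof -
  have new: "s \<notin> range Left" "s \<notin> range Right" if "s \<in> {A1, A2, B1, B2}"
    for s :: "('a, 'b) sj_vertex"
    using that by auto
  note defs = split_join_def new doubleton_eq_iff
  show "esign \<Gamma> {Left u, A1} = 1" "esign \<Gamma> {Left u, A2} = 1" "esign \<Gamma> {Left u, B1} = 1"
    by (simp_all add: defs)
  show "esign \<Gamma> {Right x, A2} = 1" "esign \<Gamma> {Right x, B1} = 1" "esign \<Gamma> {Right x, B2} = 1"
    by (simp_all add: defs)
  show "esign \<Gamma> {Left u, B2} = -1" if "u \<in> L.M" using that by (simp add: defs)
  show "esign \<Gamma> {Right x, A1} = -1" if "x \<in> R.M" using that by (simp add: defs)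
qed

lemma parcs_split_join_commute: "(s, t) \<in> E \<longleftrightarrow> (t, s) \<in> E"
  by (cases s; cases t) (use parcs_commute[OF L.sg] parcs_commute[OF R.sg] in auto)

lemma signed_graph_split_join: "signed_graph \<Gamma>"
proof -
  interpret L': pair_graph "ugraph \<Gamma>1" using L.sg by (simp add: signed_graph_def)
  interpret R': pair_graph "ugraph \<Gamma>2" using R.sg by (simp add: signed_graph_def)
  have arcs_in: "s \<in> svertices \<Gamma>" if "(s, t) \<in> E" for s t
    using that L.P_subset L.M_subset R.P_subset R.M_subset
    by (cases s; cases t) (auto simp: svertices_split_join dest: L'.in_arcsD1 R'.in_arcsD1)
  have finV: "finite (svertices \<Gamma>)"
    using L.fin R.fin by (simp add: svertices_split_join)
  have sub: "E \<subseteq> svertices \<Gamma> \<times> svertices \<Gamma>"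
    using arcs_in parcs_split_join_commute by fastforce
  have "pair_graph (ugraph \<Gamma>)"
  proof
    show "finite E" using sub finV by (auto intro: finite_subset)
    show "symmetric (with_proj (ugraph \<Gamma>))"
      using parcs_split_join_commute by (auto simp: symmetric_def intro: symI)
    show "fst e \<noteq> snd e" if "e \<in> E" for e
    proof -
      have "(s, s) \<notin> E" for s
        by (cases s) (use not_in_own_nbrs[OF L.sg] not_in_own_nbrs[OF R.sg] in \<open>auto simp: nbrs_def\<close>)
      with that show ?thesis by (metis prod.collapse)
    qed
  qed (use sub finV in auto)
  moreover have "esign \<Gamma> {s, t} \<in> {1, -1}" if "(s, t) \<in> E" for s t
  proof -
    consider u v where "s = Left u" "t = Left v" | x y where "s = Right x" "t = Right y"
      | "\<nexists>u v. s = Left u \<and> t = Left v" "\<nexists>x y. s = Right x \<and> t = Right y"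
      by blast
    then show ?thesis
    proof cases
      case 1
      then show ?thesis using that esign_cases[OF L.sg] by (auto simp: esign_Left nbrs_def)
    next
      case 2
      then show ?thesis using that esign_cases[OF R.sg] by (auto simp: esign_Right nbrs_def)
    next
      case 3
      then have "\<not> {s, t} \<subseteq> range Left" "\<not> {s, t} \<subseteq> range Right" by auto
      \<comment> \<open>Only the last two branches of the signature remain, with values
        \<open>-1\<close> and \<open>1\<close>.\<close>
      then show ?thesis unfolding split_join_def by (simp del: insert_subset)
    qed
  qed
  ultimately show ?thesis by (auto simp: signed_graph_def)
qed

section \<open>The square of the signed adjacency matrix\<close>

lemma adj_mat_split_join [simp]:
  "u \<in> L.V \<Longrightarrow> v \<in> L.V \<Longrightarrow> A (Left u) (Left v) = L.A u v"
  "x \<in> R.V \<Longrightarrow> y \<in> R.V \<Longrightarrow> A (Right x) (Right y) = R.A x y"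
  "A (Left u) (Right x) = 0"
  "A (Left u) A1 = of_bool (u \<in> L.P)" "A (Left u) A2 = of_bool (u \<in> L.P)"
  "A (Left u) B1 = of_bool (u \<in> L.M)" "A (Left u) B2 = - of_bool (u \<in> L.M)"
  "A (Right x) A1 = - of_bool (x \<in> R.M)" "A (Right x) A2 = of_bool (x \<in> R.M)"
  "A (Right x) B1 = of_bool (x \<in> R.P)" "A (Right x) B2 = of_bool (x \<in> R.P)"
  "s \<in> {A1, A2, B1, B2} \<Longrightarrow> t \<in> {A1, A2, B1, B2} \<Longrightarrow> A s t = 0"
  by (simp_all add: adj_mat_def esign_Left esign_Right esign_new)

text \<open>Orients mixed entries with the old vertex first, the form in which they are
  evaluated.\<close>

lemma adj_mat_split_join_sym [simp]:
  "A (Right x) (Left u) = A (Left u) (Right x)"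
  "A A1 (Left u) = A (Left u) A1" "A A2 (Left u) = A (Left u) A2"
  "A B1 (Left u) = A (Left u) B1" "A B2 (Left u) = A (Left u) B2"
  "A A1 (Right x) = A (Right x) A1" "A A2 (Right x) = A (Right x) A2"
  "A B1 (Right x) = A (Right x) B1" "A B2 (Right x) = A (Right x) B2"
  by (rule adj_mat_commute[OF signed_graph_split_join])+

lemma sum_split_join:
  "(\<Sum>w\<in>svertices \<Gamma>. f w) = (\<Sum>u\<in>L.V. f (Left u)) + (\<Sum>x\<in>R.V. f (Right x)) +
    f A1 + f A2 + f B1 + f B2" for f :: "('a, 'b) sj_vertex \<Rightarrow> int"
proof -
  have inj: "inj_on Left L.V" "inj_on Right R.V" by (auto intro: inj_onI)
  have "(\<Sum>w\<in>svertices \<Gamma>. f w) =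
      (\<Sum>w\<in>Left ` L.V \<union> Right ` R.V. f w) + (\<Sum>w\<in>{A1, A2, B1, B2}. f w)"
    unfolding svertices_split_join using L.fin R.fin by (intro sum.union_disjoint) auto
  also have "(\<Sum>w\<in>Left ` L.V \<union> Right ` R.V. f w) = (\<Sum>w\<in>Left ` L.V. f w) + (\<Sum>w\<in>Right ` R.V. f w)"
    using L.fin R.fin by (intro sum.union_disjoint) auto
  finally show ?thesis by (simp add: sum.reindex[OF inj(1)] sum.reindex[OF inj(2)])
qed

lemma mat_prod_split_join:
  assumes "s \<in> svertices \<Gamma>" and "t \<in> svertices \<Gamma>"
  shows "mat_prod (svertices \<Gamma>) A A s t = (if s = t then 2 * int l else 0)"
proof -
  \<comment> \<open>\<open>A1\<close> and \<open>A2\<close> restore the \<open>2\<close> lost on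
    \<open>L.P\<close>; \<open>B1\<close> and \<open>B2\<close> restore it on \<open>L.M\<close>,
    where the two minus signs at \<open>B2\<close> multiply to \<open>1\<close>.\<close>
  have LL: "mat_prod (svertices \<Gamma>) A A (Left u) (Left v) = (if u = v then 2 * int l else 0)"
    if "u \<in> L.V" "v \<in> L.V" for u v
  proof -
    have "(\<Sum>w\<in>L.V. A (Left u) (Left w) * A (Left w) (Left v)) = (\<Sum>w\<in>L.V. L.A u w * L.A w v)"
      using that by (intro sum.cong) simp_all
    then show ?thesis
      using that L.P_Int_M
      by (auto simp: mat_prod_def sum_split_join L.sum_A_A simp del: DiffI Diff_iff)
  qed
  have RR: "mat_prod (svertices \<Gamma>) A A (Right u) (Right v) = (if u = v then 2 * int l else 0)"
    if "u \<in> R.V" "v \<in> R.V" for u v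
  proof -
    have "(\<Sum>w\<in>R.V. A (Right u) (Right w) * A (Right w) (Right v)) = (\<Sum>w\<in>R.V. R.A u w * R.A w v)"
      using that by (intro sum.cong) simp_all
    then show ?thesis
      using that R.P_Int_M
      by (auto simp: mat_prod_def sum_split_join R.sum_A_A simp del: DiffI Diff_iff)
  qed
  \<comment> \<open>The walks through \<open>A1\<close> and \<open>A2\<close> cancel, since
    \<open>A1\<close> is negative on \<open>R.M\<close>; those through \<open>B1\<close> and
    \<open>B2\<close> cancel, since \<open>B2\<close> is negative on \<open>L.M\<close>.\<close>
  have LR: "mat_prod (svertices \<Gamma>) A A (Left u) (Right x) = 0" for u x
    by (simp add: mat_prod_def sum_split_join)
  have LN: "mat_prod (svertices \<Gamma>) A A (Left u) n = 0"
    if "u \<in> L.V" "n \<in> {A1, A2, B1, B2}" for u n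
  proof -
    \<comment> \<open>New vertices are pairwise non-adjacent, so only walks through old vertices
      remain. They give a row sum over \<open>L.P\<close> or \<open>L.M\<close>, up to sign.\<close>
    have "(\<Sum>w\<in>L.V. A (Left u) (Left w) * of_bool (w \<in> L.P)) = 0"
      "(\<Sum>w\<in>L.V. A (Left u) (Left w) * of_bool (w \<in> L.M)) = 0"
      using that L.P_subset L.M_subset L.sum_A_P_M[of u]
      unfolding L.sum_of_bool_P L.sum_of_bool_M by (simp_all add: subset_eq)
    then show ?thesis
      using that(2) by (auto simp: mat_prod_def sum_split_join sum_negf)
  qed
  have RN: "mat_prod (svertices \<Gamma>) A A (Right x) n = 0"
    if "x \<in> R.V" "n \<in> {A1, A2, B1, B2}" for x n
  proof -
    have "(\<Sum>w\<in>R.V. A (Right x) (Right w) * of_bool (w \<in> R.P)) = 0"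
      "(\<Sum>w\<in>R.V. A (Right x) (Right w) * of_bool (w \<in> R.M)) = 0"
      using that R.P_subset R.M_subset R.sum_A_P_M[of x]
      unfolding R.sum_of_bool_P R.sum_of_bool_M by (simp_all add: subset_eq)
    then show ?thesis
      using that(2) by (auto simp: mat_prod_def sum_split_join sum_negf)
  qed
  \<comment> \<open>Distinct vertices of one pair give \<open>l - l\<close>, one side contributing
    each term; a vertex of each pair have no common neighbour.\<close>
  have NN: "mat_prod (svertices \<Gamma>) A A m n = (if m = n then 2 * int l else 0)"
    if "m \<in> {A1, A2, B1, B2}" "n \<in> {A1, A2, B1, B2}" for m n
    using that by (auto simp: mat_prod_def sum_split_join sum_negf L.sum_P_M R.sum_P_M)
  have commute: "mat_prod (svertices \<Gamma>) A A s t = mat_prod (svertices \<Gamma>) A A t s" for s t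
    unfolding mat_prod_def
    by (intro sum.cong) (simp_all add: adj_mat_commute[OF signed_graph_split_join, of s]
        adj_mat_commute[OF signed_graph_split_join, of _ t] mult.commute)
  have cases: "(\<exists>u\<in>L.V. s = Left u) \<or> (\<exists>x\<in>R.V. s = Right x) \<or> s \<in> {A1, A2, B1, B2}"
    if "s \<in> svertices \<Gamma>" for s
    using that unfolding svertices_split_join by blast
  have NL: "mat_prod (svertices \<Gamma>) A A n (Left u) = 0"
    if "u \<in> L.V" "n \<in> {A1, A2, B1, B2}" for u n
    using LN[OF that] by (simp only: commute[of n])
  have NR: "mat_prod (svertices \<Gamma>) A A n (Right x) = 0"
    if "x \<in> R.V" "n \<in> {A1, A2, B1, B2}" for x n
    using RN[OF that] by (simp only: commute[of n])
  have RL: "mat_prod (svertices \<Gamma>) A A (Right x) (Left u) = 0" for x u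
    using LR by (simp only: commute[of "Right x"])
  have old_neq_new: "Left u \<noteq> n" "Right x \<noteq> n" "n \<noteq> Left u" "n \<noteq> Right x"
    if "n \<in> {A1, A2, B1, B2}" for u x and n :: "('a, 'b) sj_vertex"
    using that by auto
  from cases[OF assms(1)] cases[OF assms(2)] show ?thesis
    by (elim disjE bexE)
      (simp_all only: LL RR NN LR RL LN NL RN NR old_neq_new sj_vertex.inject sj_vertex.distinct
        if_False simp_thms)
qed

lemma regular_split_join: "regular (2 * l) \<Gamma>"
  unfolding regular_def
proof
  fix s assume "s \<in> svertices \<Gamma>"
  then have "int (card (nbrs \<Gamma> s)) = int (2 * l)"
    using mat_prod_split_join[of s s] mat_prod_adj_mat_diag[OF signed_graph_split_join, of s] by simp
  then show "card (nbrs \<Gamma> s) = 2 * l" by simp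
qed

section \<open>Connectivity of the split and join\<close>

lemma connected_split_join:
  assumes "connected (with_proj (ugraph \<Gamma>1) \<restriction> L.V)"
  shows "connected (with_proj (ugraph \<Gamma>))"
proof -
  interpret pair_graph "ugraph \<Gamma>"
    using signed_graph_split_join by (simp add: signed_graph_def)
  define reach where "reach s \<longleftrightarrow> (A1, s) \<in> E\<^sup>*" for s
  have step: "reach s \<Longrightarrow> (s, t) \<in> E \<Longrightarrow> reach t" for s t
    unfolding reach_def by (rule rtrancl_into_rtrancl)
  have reach_A1: "reach A1" by (simp add: reach_def)
  \<comment> \<open>\<open>p\<close> links \<open>A1\<close> to the left part and leads on to
    \<open>A2\<close>; \<open>m\<close> leads from the left part to \<open>B1\<close> and
    \<open>B2\<close>.\<close>
  obtain p m where p: "p \<in> L.P" and m: "m \<in> L.M" using L.P_M_nonempty by auto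
  have reach_Left: "reach (Left u)" if "u \<in> L.V" for u
  proof (rule connected_induct[OF assms, of p u "\<lambda>u. reach (Left u)"])
    show "reach (Left p)" using step[OF reach_A1] p by simp
    fix x y
    assume "x \<in> verts (with_proj (ugraph \<Gamma>1) \<restriction> L.V)" "y \<in> verts (with_proj (ugraph \<Gamma>1) \<restriction> L.V)"
      and "(x, y) \<in> arcs_ends (with_proj (ugraph \<Gamma>1) \<restriction> L.V) \<or>
        (y, x) \<in> arcs_ends (with_proj (ugraph \<Gamma>1) \<restriction> L.V)"
      and "reach (Left x)"
    then show "reach (Left y)"
      using step[of "Left x" "Left y"] parcs_commute[OF L.sg, of x y] by (auto simp: arcs_ends_conv)
  qed (use that p L.P_subset in auto)
  have new: "reach A2" "reach B1" "reach B2"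
    using step[OF reach_Left, of p A2] step[OF reach_Left, of m B1] step[OF reach_Left, of m B2]
      p m L.P_subset L.M_subset by auto
  \<comment> \<open>A walk in \<open>\<Gamma>2\<close> may pass through the deleted
    \<open>a'\<close> or \<open>b'\<close>, so the invariant admits them. The next vertex then lies
    in \<open>R.P\<close> or \<open>R.M\<close> and is reached afresh from \<open>B1\<close> or
    \<open>A1\<close>.\<close>
  have reach_Right: "x \<in> {a', b'} \<or> reach (Right x)" if "x \<in> svertices \<Gamma>2" for x
  proof (rule connected_induct[OF R.conn, of a' x "\<lambda>x. x \<in> {a', b'} \<or> reach (Right x)"])
    fix x y
    assume "(x, y) \<in> arcs_ends (with_proj (ugraph \<Gamma>2)) \<or> (y, x) \<in> arcs_ends (with_proj (ugraph \<Gamma>2))"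
      and reach: "x \<in> {a', b'} \<or> reach (Right x)"
    then have xy: "(x, y) \<in> parcs (ugraph \<Gamma>2)" using parcs_commute[OF R.sg, of x y] by auto
    show "y \<in> {a', b'} \<or> reach (Right y)"
    proof (cases "x \<in> {a', b'}")
      case True
      then have "y \<in> nbrs \<Gamma>2 a'" using xy R.twins by (auto simp: nbrs_def)
      then have "y \<in> R.P \<or> y \<in> R.M" using R.P_Un_M by auto
      then show ?thesis using step[OF reach_A1, of "Right y"] step[OF new(2), of "Right y"] by auto
    next
      case False
      then show ?thesis using reach xy step[of "Right x" "Right y"] by auto
    qed
  qed (use that R.a_in in auto)
  show ?thesis
  proof (rule connected_if_root)
    show "A1 \<in> svertices \<Gamma>" by (simp add: svertices_split_join)
    show "(A1, v) \<in> E\<^sup>*" if "v \<in> svertices \<Gamma>" for v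
      using that reach_A1 new reach_Left reach_Right
      by (auto simp: svertices_split_join reach_def[symmetric])
  qed
qed

lemma orthogonal_split_join:
  assumes "connected (with_proj (ugraph \<Gamma>1) \<restriction> L.V)"
  shows "orthogonal \<Gamma>"
  using signed_graph_split_join connected_split_join[OF assms] mat_prod_split_join regular_split_join
  by (simp add: orthogonal_def degree_mat_def regular_def)

end

theorem lemma3p5:
  fixes \<Gamma>1 :: "'a sgraph" and \<Gamma>2 :: "'b sgraph"
    and a b :: 'a and a' b' :: 'b and l :: nat
  assumes "signed_graph \<Gamma>1" and "regular (2 * l) \<Gamma>1" and "orthogonal \<Gamma>1"
    and "signed_graph \<Gamma>2" and "regular (2 * l) \<Gamma>2" and "orthogonal \<Gamma>2"
    and "splittable l \<Gamma>1 a b"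
    and "splittable l \<Gamma>2 a' b'"
    and "k_connected 3 \<Gamma>1"
  defines "\<Gamma> \<equiv> split_join (normalise a \<Gamma>1) a b (normalise a' \<Gamma>2) a' b'"
  shows "signed_graph \<Gamma> \<and> regular (2 * l) \<Gamma> \<and> orthogonal \<Gamma>"
proof -
  interpret twin_pairs "normalise a \<Gamma>1" a b "normalise a' \<Gamma>2" a' b' l
    by (intro twin_pairs.intro positive_twins_normalise assms)
  \<comment> \<open>A 3-connected graph survives the loss of these two vertices, and normalising
    keeps the underlying graph.\<close>
  have "{a, b} \<subseteq> svertices \<Gamma>1" "card {a, b} < 3"
    using L.a_in L.b_in L.a_neq_b by simp_all
  with assms(9) have "connected (with_proj (ugraph (normalise a \<Gamma>1)) \<restriction> L.V)"
    unfolding k_connected_def by simp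
  then show ?thesis
    unfolding \<Gamma>_def
    by (intro conjI signed_graph_split_join regular_split_join orthogonal_split_join)
qed

end
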